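(* For $N\ge1$ let $M_N$ be the $N\times N$ matrix with entries $$M_N(i,j)=\rho\bigl(x^i(1+x)^j\bigr)\,2^{-\lfloor j/2\rfloor},\qquad 0\le i,j\le N-1 ,$$ where $\rho$ is the evaluation of palindromic polynomials defined in the context. Then for all $N\ge1$, $$\det M_N=2^{-\binom N2}\,\ddot H_N\bigl((1+x)/\cos x\bigr) =\bigl((N-1)!!\bigr)^2\prod_{k=1}^{N-2}(k!!)^6 =\prod_{k=1}^{N-1}\bigl((N-k)!\bigr)^{\epsilon(k)},$$ where $\epsilon(k)=2$ for $k$ odd and $\epsilon(k)=4$ for $k$ even.
   Context: The index of a nonzero polynomial is its degree plus its valuation (the order of vanishing at $0$). A polynomial $P\in\mathbb Q[x]$ is palindromic of index $d$ if $x^dP(1/x)=P(x)$; e.g. $x^i(1+x)^j$ is palindromic of index $2i+j$. For $P$ palindromic of index $d$ put $$\mathscr N_0(P)=\frac{(x^{d}+1)\,P(1)-2P(x)}{(x-1)^2},$$ which is a polynomial, palindromic of index $d-2$ when nonzero (and $\mathscr N_0(0)=0$). Define $\rho(P)$ to be the constant term of $\mathscr N_0^{\lfloor d/2\rfloor}(P)$ (at each iteration $\mathscr N_0$ is formed with the current index); in particular $\rho(1)=1$ and $\rho(c(1+x))=c$. For a power series $f(x)=\sum_{k\ge0}a_kx^k/k!$, the dilated Hankel determinant is $\ddot H_N(f)=\det(a_{2i+j})_{0\le i,j\le N-1}$. Conventions: $m!!=m(m-2)(m-4)\cdots$ down to $1$ or $2$, with $0!!=(-1)!!=1$; empty products equal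 $1$. *)

theory Defs
  imports
    "Jordan_Normal_Form.Determinant"
    "HOL-Computational_Algebra.Computational_Algebra"
begin

text \<open>
  The index is only meaningful for nonzero polynomials.
\<close>

definition pindex :: "rat poly \<Rightarrow> nat" where
  "pindex P = degree P + order 0 P"

definition palindromic :: "nat \<Rightarrow> rat poly \<Rightarrow> bool" where
  "palindromic d P \<longleftrightarrow> (\<forall>x. x \<noteq> 0 \<longrightarrow> x ^ d * poly P (1 / x) = poly P x)"

text \<open>
  The operator below is total, and intended for palindromic polynomials only. A nonzero polynomial
  that is palindromic of index \<open>d\<close> satisfies \<open>d = pindex P\<close> (lemma \<open>palindromic_pindex\<close>), so the
  index need not be passed as an argument. For palindromic \<open>P\<close> the division is
  exact (lemma \<open>N0_exact\<close>) and the result is palindromic of index \<open>d - 2\<close>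
  (lemma \<open>palindromic_N0\<close>).
\<close>

definition N0_num :: "rat poly \<Rightarrow> rat poly" where
  "N0_num P = smult (poly P 1) (monom 1 (pindex P) + 1) - smult 2 P"

definition N0 :: "rat poly \<Rightarrow> rat poly" where
  "N0 P = (if P = 0 then 0 else N0_num P div [:-1, 1:] ^ 2)"

definition rho :: "rat poly \<Rightarrow> rat" where
  "rho P = coeff ((N0 ^^ (pindex P div 2)) P) 0"

definition M_mat :: "nat \<Rightarrow> rat mat" where
  "M_mat N = mat N N (\<lambda>(i, j). rho ([:0, 1:] ^ i * [:1, 1:] ^ j) * (1 / 2 ^ (j div 2)))"

text \<open>
  The power series \<open>f = (\<Sum>k. a k * x ^ k / k!)\<close> is represented by its ordinary coefficients, so
  \<open>a k = k! * fps_nth f k\<close>.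
\<close>

definition dilated_hankel :: "nat \<Rightarrow> rat fps \<Rightarrow> rat" where
  "dilated_hankel N f = det (mat N N (\<lambda>(i, j). fact (2 * i + j) * fps_nth f (2 * i + j)))"

fun double_fact :: "nat \<Rightarrow> nat" where
  "double_fact 0 = 1"
| "double_fact (Suc 0) = 1"
| "double_fact (Suc (Suc n)) = Suc (Suc n) * double_fact n"

definition eps :: "nat \<Rightarrow> nat" where
  "eps k = (if odd k then 2 else 4)"

lemma poly_eqI_cofinite:
  fixes p q :: "rat poly"
  assumes "\<And>x. x \<noteq> 0 \<Longrightarrow> x \<noteq> 1 \<Longrightarrow> poly p x = poly q x"
  shows "p = q"
proof (rule ccontr)
  assume "p \<noteq> q"
  then have "finite {x. poly (p - q) x = 0}" by (intro poly_roots_finite) simp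
  moreover have "UNIV - {0, 1} \<subseteq> {x. poly (p - q) x = 0}" using assms by auto
  ultimately have "finite (UNIV - {0, 1 :: rat})" by (rule rev_finite_subset)
  then show False using infinite_UNIV_char_0 [where ?'a = rat] by simp
qed

lemma palindromic_pindex:
  assumes "palindromic d P" and "P \<noteq> 0"
  shows "pindex P = d"
proof -
  have "monom 1 d * reflect_poly P = monom 1 (degree P) * P"
  proof (rule poly_eqI_cofinite)
    fix x :: rat
    assume "x \<noteq> 0" "x \<noteq> 1"
    then show "poly (monom 1 d * reflect_poly P) x = poly (monom 1 (degree P) * P) x"
      using assms(1) unfolding palindromic_def
      by (simp add: poly_monom poly_reflect_poly_nz inverse_eq_divide mult.left_commute)
  qed
  then have "order 0 (monom 1 d * reflect_poly P) = order 0 (monom 1 (degree P) * P)" by simp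
  moreover have "order 0 (reflect_poly P) = 0"
    by (rule order_0I) (simp add: assms(2))
  moreover have "order 0 (monom (1 :: rat) n) = n" for n
    by (metis diff_zero minus_zero monom_altdef order_power_n_n smult_1_left)
  ultimately show ?thesis
    using assms(2) by (simp add: order_mult pindex_def)
qed

lemma palindromic_x_power_1_plus_x_power:
  "palindromic (2 * i + j) ([:0, 1:] ^ i * [:1, 1:] ^ j)"
  unfolding palindromic_def
proof (intro allI impI)
  fix x :: rat
  assume x: "x \<noteq> 0"
  have "x ^ (2 * i + j) * poly ([:0, 1:] ^ i * [:1, 1:] ^ j) (1 / x)
      = (x ^ 2 * (1 / x)) ^ i * (x * (1 + 1 / x)) ^ j"
  proof -
    have "poly ([:0, 1:] ^ i * [:1, 1:] ^ j) (1 / x) = (1 / x) ^ i * (1 + 1 / x) ^ j" by simp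
    moreover have "x ^ (2 * i + j) = (x ^ 2) ^ i * x ^ j" by (simp only: power_add power_mult)
    ultimately show ?thesis by (simp only: power_mult_distrib mult.assoc mult.left_commute)
  qed
  also have "x ^ 2 * (1 / x) = x" using x by (simp add: power2_eq_square)
  also have "x * (1 + 1 / x) = 1 + x" using x by (simp add: field_simps)
  finally show "x ^ (2 * i + j) * poly ([:0, 1:] ^ i * [:1, 1:] ^ j) (1 / x)
      = poly ([:0, 1:] ^ i * [:1, 1:] ^ j) x" by simp
qed

lemma palindromic_N0_num:
  assumes "palindromic d P" and "P \<noteq> 0"
  shows "palindromic d (N0_num P)"
proof -
  have eq: "x ^ d * (c * ((1 / x) ^ d + 1) - 2 * y) = c * (x ^ d + 1) - 2 * (x ^ d * y)"
    if "x \<noteq> 0" for x c y :: rat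
    using that by (simp add: field_simps)
  show ?thesis
    using assms(1) palindromic_pindex[OF assms]
    by (simp add: palindromic_def N0_num_def poly_monom eq)
qed

lemma N0_exact:
  assumes "palindromic d P" and "P \<noteq> 0"
  shows "N0 P * [:-1, 1:] ^ 2 = N0_num P"
proof -
  define Q where "Q = N0_num P"
  have pal: "palindromic d Q"
    using palindromic_N0_num[OF assms] by (simp add: Q_def)
  have "poly Q 1 = 0" by (simp add: Q_def N0_num_def poly_monom)
  then obtain R where R: "Q = [:-1, 1:] * R" by (auto simp: poly_eq_0_iff_dvd)
  have "- (monom 1 d * reflect_poly R) = monom 1 (Suc (degree R)) * R"
  proof (rule poly_eqI_cofinite)
    fix x :: rat
    assume x: "x \<noteq> 0" "x \<noteq> 1"
    have "x ^ d * ((1 / x - 1) * poly R (1 / x)) = (x - 1) * poly R x"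
      using pal x unfolding palindromic_def R by (simp add: algebra_simps)
    then have "x * (x ^ d * ((1 / x - 1) * poly R (1 / x))) = x * ((x - 1) * poly R x)" by simp
    moreover have "x * (1 / x - 1) = - (x - 1)" using x by (simp add: field_simps)
    then have "x * (x ^ d * ((1 / x - 1) * poly R (1 / x))) = - (x - 1) * (x ^ d * poly R (1 / x))"
      by (metis mult.assoc mult.left_commute)
    ultimately have "(x - 1) * (- (x ^ d * poly R (1 / x))) = (x - 1) * (x * poly R x)"
      by (simp add: algebra_simps)
    then have "- (x ^ d * poly R (1 / x)) = x * poly R x"
      using x by (metis mult_left_cancel right_minus_eq)
    then have "x ^ degree R * (- (x ^ d * poly R (1 / x))) = x ^ degree R * (x * poly R x)" by simp
    then show "poly (- (monom 1 d * reflect_poly R)) x = poly (monom 1 (Suc (degree R)) * R) x"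
      using x by (simp add: poly_monom poly_reflect_poly_nz inverse_eq_divide mult_ac)
  qed
  then have "poly (- (monom 1 d * reflect_poly R)) 1 = poly (monom 1 (Suc (degree R)) * R) 1"
    by simp
  then have "poly R 1 = 0" by (simp add: poly_monom poly_reflect_poly_nz)
  then have "[:-1, 1:] ^ 2 dvd Q"
    by (simp only: R poly_eq_0_iff_dvd power2_eq_square mult_dvd_mono dvd_refl)
  then show ?thesis using assms(2) by (simp add: N0_def Q_def)
qed

lemma palindromic_N0:
  assumes "palindromic d P" and "P \<noteq> 0" and "d \<ge> 2"
  shows "palindromic (d - 2) (N0 P)"
  unfolding palindromic_def
proof (intro allI impI)
  fix x :: rat
  assume x: "x \<noteq> 0"
  show "x ^ (d - 2) * poly (N0 P) (1 / x) = poly (N0 P) x"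
  proof (cases "x = 1")
    case False
    have num: "poly (N0_num P) y = poly (N0 P) y * (y - 1) ^ 2" for y
      by (subst N0_exact[OF assms(1,2), symmetric]) simp
    have "x ^ d * (1 / x - 1) ^ 2 = x ^ (d - 2) * (x * (1 / x - 1)) ^ 2"
      using assms(3) by (simp only: power_mult_distrib le_add_diff_inverse2
          flip: mult.assoc power_add)
    also have "x * (1 / x - 1) = - (x - 1)" using x by (simp add: field_simps)
    finally have "x ^ d * (1 / x - 1) ^ 2 = x ^ (d - 2) * (x - 1) ^ 2"
      by (simp add: power2_commute)
    moreover have "x ^ d * (poly (N0 P) (1 / x) * (1 / x - 1) ^ 2) = poly (N0 P) x * (x - 1) ^ 2"
      using palindromic_N0_num[OF assms(1,2)] x unfolding palindromic_def num by blast
    ultimately have "x ^ (d - 2) * poly (N0 P) (1 / x) * (x - 1) ^ 2 = poly (N0 P) x * (x - 1) ^ 2"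
      by (metis mult.assoc mult.commute)
    then show ?thesis using False by simp
  qed simp
qed

lemma rho_1: "rho 1 = 1"
  by (simp add: rho_def pindex_def)

lemma rho_1_plus_x: "rho [:c, c:] = c"
proof (cases "c = 0")
  case False
  then have "order 0 [:c, c:] = 0" by (intro order_0I) simp
  then show ?thesis using False by (simp add: rho_def pindex_def)
next
  case True
  have "(N0 ^^ n) 0 = 0" for n by (induction n) (simp_all add: N0_def)
  then show ?thesis using True by (simp add: rho_def)
qed

end

theory Submission
  imports Defs
begin

text \<open>
  Let \<open>f = (1 + x) / cos x\<close>, with coefficients \<open>a\<^sub>k / k!\<close>, and let \<open>\<Lambda>\<close> be the linear functional on
  polynomials with \<open>\<Lambda>(x\<^sup>k) = a\<^sub>k\<close>.

  Substituting \<open>x = e\<^bsup>2it\<^esup>\<close> turns a palindromic \<open>P\<close> of index \<open>d\<close> into an even form of degree \<open>d\<close> in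
  \<open>c = cos t\<close> and \<open>s = sin t\<close>, and \<open>P(x) = (P(1)/2) (x\<^sup>d + 1) - (x - 1)\<^sup>2 N\<^sub>0(P)/2\<close> becomes a
  decomposition into \<open>cos (d t)\<close> and \<open>s\<^sup>2\<close> times a form of degree \<open>d - 2\<close>. The functional
  \<open>c\<^sup>j s\<^sup>2\<^sup>k \<mapsto> a\<^sub>j\<close> kills \<open>cos (d t)\<close> for \<open>d \<ge> 2\<close>, because \<open>f \<sqdot> cos\<close> is linear, so up to a power of 2 it
  is \<open>\<rho>\<close>. Writing \<open>1 = c\<^sup>2 + s\<^sup>2\<close> in the image \<open>(2c)\<^sup>j\<close> of \<open>x\<^sup>i (1 + x)\<^sup>j\<close> gives
  \<open>M\<^sub>N(i,j) = 2\<^sup>-\<^sup>i \<Lambda>((1 + x\<^sup>2)\<^sup>i x\<^sup>j)\<close>, which is a triangular row transformation of the dilated Hankel matrix.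

  For the Hankel determinant, replace \<open>x\<^sup>2\<^sup>i\<close> by \<open>B\<^sub>i = \<Prod>\<^bsub>k<i\<^esub> (x\<^sup>2 + (2k+1)\<^sup>2)\<close> and \<open>x\<^sup>j\<close> by \<open>A\<^sub>j\<close>, where
  \<open>A\<^sub>0 = 1\<close>, \<open>A\<^sub>1 = x\<close>, \<open>A\<^sub>j\<^sub>+\<^sub>2 = (x\<^sup>2 + j\<^sup>2) A\<^sub>j\<close>. Both changes are unitriangular.
  The functional sends \<open>A\<^sub>j\<close> to \<open>j!\<close> times the \<open>j\<close>-th coefficient of \<open>f\<close> expanded in powers of
  \<open>sin x\<close>, that is to \<open>((j-1)!!)\<^sup>2\<close>. Since \<open>B\<^sub>i\<^sub>+\<^sub>1 A\<^sub>j = B\<^sub>i A\<^sub>j\<^sub>+\<^sub>2 + ((2i+1)\<^sup>2 - j\<^sup>2) B\<^sub>i A\<^sub>j\<close>, this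
  yields \<open>\<Lambda>(B\<^sub>i A\<^sub>j) = 2\<^sup>i i! (2i+j-1)!! (j-1)!!\<close>, whose determinant is of Vandermonde type.
\<close>

section \<open>The umbral functional and expansions in powers of the sine\<close>

text \<open>This is \<open>p\<close> at \<open>d/dx\<close> applied to \<open>g\<close> and
  evaluated at 0, so multiplying \<open>p\<close> by x differentiates \<open>g\<close>.\<close>

definition umbral :: "rat fps \<Rightarrow> rat poly \<Rightarrow> rat" where
  "umbral g p = (\<Sum>n\<le>degree p. coeff p n * (fact n * fps_nth g n))"

lemma umbral_eq_sum:
  assumes "degree p \<le> m"
  shows "umbral g p = (\<Sum>n\<le>m. coeff p n * (fact n * fps_nth g n))"
  unfolding umbral_def using assms by (intro sum.mono_neutral_left) (auto simp: coeff_eq_0)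

lemma umbral_add: "umbral g (p + q) = umbral g p + umbral g q"
proof -
  define m where "m = max (degree p) (degree q)"
  have "degree p \<le> m" "degree q \<le> m" "degree (p + q) \<le> m"
    by (auto simp: m_def degree_add_le)
  then show ?thesis by (simp add: umbral_eq_sum algebra_simps sum.distrib)
qed

lemma umbral_smult: "umbral g (smult c p) = c * umbral g p"
  using umbral_eq_sum[of "smult c p" "degree p" g]
  by (simp add: umbral_def degree_smult_le sum_distrib_left mult.assoc)

lemma umbral_monom: "umbral g (monom 1 n) = fact n * fps_nth g n"
  by (simp add: umbral_def degree_monom_eq if_distrib[of "\<lambda>c. c * _"] cong: if_cong)

lemma umbral_fps_add: "umbral (g + h) p = umbral g p + umbral h p"
  by (simp add: umbral_def algebra_simps sum.distrib)

lemma umbral_fps_const_mult: "umbral (fps_const c * g) p = c * umbral g p"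
  by (simp add: umbral_def sum_distrib_left mult.assoc mult.left_commute)

lemma umbral_times_X: "umbral g ([:0, 1:] * p) = umbral (fps_deriv g) p"
proof -
  have "umbral g ([:0, 1:] * p) = (\<Sum>n\<le>Suc (degree p). coeff ([:0, 1:] * p) n * (fact n * fps_nth g n))"
    by (intro umbral_eq_sum) (simp add: degree_pCons_eq_if)
  also have "\<dots> = umbral (fps_deriv g) p"
    unfolding umbral_def sum.atMost_Suc_shift by (simp add: algebra_simps)
  finally show ?thesis .
qed

text \<open>
  The differential operators \<open>sine_poly j\<close> at \<open>d/dx\<close> extract coefficients with respect to \<open>sin x\<close>,
  because \<open>(d/dx)\<^sup>2 + j\<^sup>2\<close> maps \<open>sin\<^sup>j x\<close> to \<open>j (j-1) sin\<^sup>j\<^sup>-\<^sup>2 x\<close>.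
\<close>

fun sine_poly :: "nat \<Rightarrow> rat poly" where
  "sine_poly 0 = 1"
| "sine_poly (Suc 0) = [:0, 1:]"
| "sine_poly (Suc (Suc j)) = [:of_nat j ^ 2, 0, 1:] * sine_poly j"

lemma fps_cos_mult_self: "fps_cos (1::rat) * fps_cos 1 = 1 - fps_sin 1 ^ 2"
  using fps_sin_cos_sum_of_squares[of "1::rat"] by (simp add: power2_eq_square algebra_simps)

text \<open>The chain rule gives G''(sin x) cos^2 x - G'(sin x) sin x, and cos^2 x = 1 - sin^2 x
  makes this a series in sin x again.\<close>

lemma fps_deriv2_compose_sin:
  fixes G :: "rat fps"
  shows "fps_deriv (fps_deriv (G oo fps_sin 1)) =
    ((1 - fps_X ^ 2) * fps_deriv (fps_deriv G) - fps_X * fps_deriv G) oo fps_sin 1"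
proof -
  have "fps_deriv (fps_deriv (G oo fps_sin 1))
     = (fps_deriv (fps_deriv G) oo fps_sin 1) * (fps_cos 1 * fps_cos 1) - (fps_deriv G oo fps_sin 1) * fps_sin 1"
    by (simp add: fps_compose_deriv fps_sin_deriv fps_cos_deriv algebra_simps flip: fps_const_neg)
  also have "\<dots> = ((1 - fps_X ^ 2) * fps_deriv (fps_deriv G) - fps_X * fps_deriv G) oo fps_sin 1"
    unfolding fps_cos_mult_self
    by (simp add: fps_compose_sub_distrib fps_compose_mult_distrib flip: fps_compose_power)
  finally show ?thesis .
qed

lemma umbral_sine_poly:
  "umbral (G oo fps_sin 1) (sine_poly j) = fact j * fps_nth G j"
proof (induction j arbitrary: G rule: sine_poly.induct)
  case 1
  show ?case by (simp add: umbral_def)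
next
  case 2
  show ?case by (simp add: umbral_def fps_compose_nth)
next
  case (3 j)
  define T where "T = (1 - fps_X ^ 2) * fps_deriv (fps_deriv G) - fps_X * fps_deriv G + fps_const (of_nat j ^ 2) * G"
  have "[:of_nat j ^ 2, 0, 1:] * sine_poly j = [:0, 1:] * ([:0, 1:] * sine_poly j) + smult (of_nat j ^ 2) (sine_poly j)"
    by (simp add: algebra_simps)
  then have "umbral (G oo fps_sin 1) (sine_poly (Suc (Suc j)))
     = umbral (fps_deriv (fps_deriv (G oo fps_sin 1)) + fps_const (of_nat j ^ 2) * (G oo fps_sin 1)) (sine_poly j)"
    by (simp only: sine_poly.simps umbral_add umbral_smult umbral_times_X umbral_fps_add umbral_fps_const_mult)
  also have "fps_deriv (fps_deriv (G oo fps_sin 1)) + fps_const (of_nat j ^ 2) * (G oo fps_sin 1) = T oo fps_sin 1"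
    by (simp add: T_def fps_deriv2_compose_sin fps_compose_add_distrib fps_compose_mult_distrib)
  also have "umbral (T oo fps_sin 1) (sine_poly j) = fact j * fps_nth T j"
    by (rule 3)
  \<comment> \<open>The terms in G_j cancel: -j(j-1) - j + j^2 = 0.\<close>
  also have "fps_nth T j = of_nat (j + 2) * of_nat (j + 1) * fps_nth G (j + 2)"
    by (cases j rule: sine_poly.cases)
       (simp_all add: T_def algebra_simps power2_eq_square numeral_2_eq_2)
  finally show ?case by (simp add: algebra_simps)
qed


section \<open>The series \<open>(1 + x) / cos x\<close>\<close>

definition sec1 :: "rat fps" where
  "sec1 = (1 + fps_X) / fps_cos 1"

text \<open>The expansion of (1 + arcsin y) / sqrt(1 - y^2), the solution G of (1 - y^2) G' - y G =
  1 with G(0) = 1.\<close>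

definition sec1_sine :: "rat fps" where
  "sec1_sine = Abs_fps (\<lambda>n. of_nat (double_fact (n - 1)) ^ 2 / fact n)"

text \<open>Truncated subtraction makes \<open>double_fact (n - 1)\<close> follow the convention \<open>(-1)!! = 1\<close> at \<open>n = 0\<close>.\<close>

lemma double_fact_Suc: "double_fact (Suc n) = Suc n * double_fact (n - 1)"
  by (cases n) auto

lemma double_fact_mult_pred: "double_fact n * double_fact (n - 1) = fact n"
  by (induction n) (auto simp: double_fact_Suc algebra_simps)

lemma sec1_sine_rec:
  "of_nat (n + 2) * fps_nth sec1_sine (n + 2) = of_nat (n + 1) * fps_nth sec1_sine n"
proof -
  have "fps_nth sec1_sine (n + 2) = (of_nat (n + 1) * of_nat (double_fact (n - 1))) ^ 2
      / (of_nat (n + 2) * (of_nat (n + 1) * fact n))"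
    by (simp add: sec1_sine_def double_fact_Suc distrib_right del: double_fact.simps)
  then have "of_nat (n + 2) * fps_nth sec1_sine (n + 2) =
      of_nat (n + 1) * (of_nat (double_fact (n - 1)) ^ 2 / fact n)"
    by (simp add: power2_eq_square del: of_nat_add of_nat_Suc)
  then show ?thesis by (simp add: sec1_sine_def)
qed

lemma sec1_mult_cos: "sec1 * fps_cos 1 = 1 + fps_X"
proof -
  have "fps_nth (fps_cos (1 :: rat)) 0 \<noteq> 0" by simp
  then show ?thesis
    unfolding sec1_def by (simp add: fps_divide_unit mult.assoc inverse_mult_eq_1)
qed

text \<open>By the differential equation \<open>K\<close>, G(sin x) cos x has derivative 1; its
  value at 0 is 1, so it equals 1 + x. No arcsine series is involved.\<close>

lemma sec1_eq_compose: "sec1 = sec1_sine oo fps_sin 1"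
proof -
  let ?G = sec1_sine
  have K: "(1 - fps_X ^ 2) * fps_deriv ?G - fps_X * ?G = 1"
  proof (rule fps_ext)
    fix n
    show "fps_nth ((1 - fps_X ^ 2) * fps_deriv ?G - fps_X * ?G) n = fps_nth 1 n"
    proof (cases n rule: sine_poly.cases)
      case (3 m)
      have "of_nat (m + 3) * fps_nth ?G (m + 3) = of_nat (m + 2) * fps_nth ?G (m + 1)"
        using sec1_sine_rec[of "m + 1"] by (simp add: eval_nat_numeral)
      then show ?thesis unfolding 3
        by (simp add: algebra_simps power2_eq_square eval_nat_numeral)
    qed (simp_all add: sec1_sine_def algebra_simps power2_eq_square)
  qed
  define H where "H = (?G oo fps_sin 1) * fps_cos 1"
  have "fps_deriv H = (fps_deriv ?G oo fps_sin 1) * (fps_cos 1 * fps_cos 1) - (?G oo fps_sin 1) * fps_sin 1"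
    by (simp add: H_def fps_compose_deriv fps_sin_deriv fps_cos_deriv algebra_simps flip: fps_const_neg)
  also have "\<dots> = ((1 - fps_X ^ 2) * fps_deriv ?G - fps_X * ?G) oo fps_sin 1"
    unfolding fps_cos_mult_self
    by (simp add: fps_compose_sub_distrib fps_compose_mult_distrib flip: fps_compose_power)
  also have "\<dots> = 1" unfolding K by simp
  finally have dH: "fps_deriv H = fps_deriv (1 + fps_X)" by simp
  have "fps_nth H 0 = 1" by (simp add: H_def sec1_sine_def)
  then have "H = 1 + fps_X" using dH fps_deriv_eq_iff[of H "1 + fps_X"] by simp
  then have "(?G oo fps_sin 1) * fps_cos 1 = sec1 * fps_cos 1"
    by (simp add: H_def sec1_mult_cos)
  moreover have "fps_cos (1 :: rat) \<noteq> 0"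
    by (metis fps_cos_nth_0 fps_zero_nth zero_neq_one)
  ultimately show ?thesis by simp
qed

lemma sec1_nth_1: "fps_nth sec1 (Suc 0) = 1"
  by (simp add: sec1_eq_compose fps_compose_nth sec1_sine_def)

lemma umbral_sec1_sine_poly: "umbral sec1 (sine_poly j) = of_nat (double_fact (j - 1)) ^ 2"
  by (simp add: sec1_eq_compose umbral_sine_poly sec1_sine_def)

lemma pcompose_linear_square: "pcompose [:c, 1:] [:0, 0, 1:] = [:c, 0, 1 :: 'a :: comm_ring_1:]"
  by (simp add: pcompose_pCons)

text \<open>The polynomial B_i written in the variable x^2, so that its degree is the row index
  \<open>i\<close>.\<close>

definition odd_square_poly :: "nat \<Rightarrow> rat poly" where
  "odd_square_poly i = (\<Prod>k<i. [:of_nat (2 * k + 1) ^ 2, 1:])"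

lemma umbral_sec1_product:
  "umbral sec1 (pcompose (odd_square_poly i) [:0, 0, 1:] * sine_poly j) =
    2 ^ i * fact i * of_nat (double_fact (2 * i + j - 1)) * of_nat (double_fact (j - 1))"
proof (induction i arbitrary: j)
  case 0
  show ?case by (simp add: odd_square_poly_def pcompose_1 umbral_sec1_sine_poly power2_eq_square)
next
  case (Suc i)
  let ?B = "pcompose (odd_square_poly i) [:0, 0, 1:]" and ?B1 = "pcompose (odd_square_poly (Suc i)) [:0, 0, 1:]" and ?c = "of_nat (2 * i + 1) ^ 2 - of_nat j ^ 2 :: rat"
  have split: "(A + [:c:]) * (B * S) = B * (A * S) + smult c (B * S)" for A B S :: "rat poly" and c
    by (simp add: algebra_simps)
  have "?B1 * sine_poly j =
      [:of_nat (2 * i + 1) ^ 2, 0, 1:] * (?B * sine_poly j)"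
    by (simp only: odd_square_poly_def prod.lessThan_Suc pcompose_mult pcompose_linear_square mult_ac)
  also have "[:of_nat (2 * i + 1) ^ 2, 0, 1:] = [:of_nat j ^ 2, 0, 1:] + [:?c:]"
    by simp
  also have "\<dots> * (?B * sine_poly j) = ?B * sine_poly (Suc (Suc j)) + smult ?c (?B * sine_poly j)"
    unfolding sine_poly.simps by (rule split)
  finally have eq: "umbral sec1 (?B1 * sine_poly j) =
      umbral sec1 (?B * sine_poly (Suc (Suc j))) + ?c * umbral sec1 (?B * sine_poly j)"
    by (simp only: umbral_add umbral_smult)
  have d: "double_fact (2 * i + j + 1) = (2 * i + j + 1) * double_fact (2 * i + j - 1)"
    "double_fact (j + 1) = (j + 1) * double_fact (j - 1)"
    using double_fact_Suc by simp_all
  define u v :: rat where "u = of_nat (double_fact (2 * i + j - 1))" and "v = of_nat (double_fact (j - 1))"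
  have d': "of_nat (double_fact (2 * i + j + 1)) = (2 * of_nat i + of_nat j + 1) * u"
    "of_nat (double_fact (j + 1)) = (of_nat j + 1) * v"
    unfolding d u_def v_def by (simp_all add: distrib_right)
  have "umbral sec1 (?B1 * sine_poly j) =
     2 ^ i * fact i * of_nat (double_fact (2 * i + j + 1)) * of_nat (double_fact (j + 1)) + ?c * (2 ^ i * fact i * u * v)"
    unfolding eq Suc.IH u_def v_def by simp
  \<comment> \<open>Both terms contain 2i+j+1, as (2i+1)^2 - j^2 factors; what remains is (j+1) +
    (2i+1-j) = 2(i+1).\<close>
  also have "\<dots> = 2 ^ i * fact i * (2 * (of_nat i + 1)) * ((2 * of_nat i + of_nat j + 1) * u) * v"
    unfolding d' by (simp add: algebra_simps power2_eq_square)
  also have "\<dots> = 2 ^ Suc i * fact (Suc i) * of_nat (double_fact (2 * Suc i + j - 1)) * of_nat (double_fact (j - 1))"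
    unfolding d'[symmetric] v_def by (simp add: algebra_simps)
  finally show ?case .
qed

section \<open>The Hankel determinant\<close>

text \<open>Expanding each \<open>P i\<close> in monomials factors the matrix as a lower triangular
  coefficient matrix times the matrix of the monomials.\<close>

lemma det_linear_functionals:
  fixes \<phi> :: "nat \<Rightarrow> 'a :: idom poly \<Rightarrow> 'a" and P :: "nat \<Rightarrow> 'a poly"
  assumes add: "\<And>j p q. \<phi> j (p + q) = \<phi> j p + \<phi> j q"
    and smult: "\<And>j c p. \<phi> j (smult c p) = c * \<phi> j p"
    and deg: "\<And>i. degree (P i) \<le> i"
  shows "det (mat N N (\<lambda>(i, j). \<phi> j (P i))) =
    (\<Prod>i<N. coeff (P i) i) * det (mat N N (\<lambda>(i, j). \<phi> j (monom 1 i)))"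
proof -
  define R where "R = mat N N (\<lambda>(i, k). coeff (P i) k)"
  define V where "V = mat N N (\<lambda>(i, j). \<phi> j (monom 1 i))"
  have zero: "\<phi> j 0 = 0" for j using smult[of j 0 0] by simp
  have sum: "\<phi> j (sum f A) = (\<Sum>k\<in>A. \<phi> j (f k))" for j A and f :: "nat \<Rightarrow> 'a poly"
    by (induction A rule: infinite_finite_induct) (simp_all add: add zero)
  have "mat N N (\<lambda>(i, j). \<phi> j (P i)) = R * V"
  proof (rule eq_matI)
    fix i j assume "i < dim_row (R * V)" "j < dim_col (R * V)"
    then have ij: "i < N" "j < N" by (auto simp: R_def V_def)
    have "P i = (\<Sum>k<N. monom (coeff (P i) k) k)"
      using deg[of i] ij
      by (intro poly_eqI) (auto simp: coeff_sum coeff_eq_0)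
    also have "\<dots> = (\<Sum>k<N. smult (coeff (P i) k) (monom 1 k))"
      by (simp add: smult_monom)
    finally have "\<phi> j (P i) = (\<Sum>k<N. coeff (P i) k * \<phi> j (monom 1 k))"
      by (metis (no_types, lifting) sum smult sum.cong)
    then show "mat N N (\<lambda>(i, j). \<phi> j (P i)) $$ (i, j) = (R * V) $$ (i, j)"
      using ij by (simp add: R_def V_def scalar_prod_def lessThan_atLeast0)
  qed (simp_all add: R_def V_def)
  moreover have "det R = (\<Prod>i<N. coeff (P i) i)"
  proof -
    have "coeff (P i) j = 0" if "i < j" for i j
      using deg[of i] that by (simp add: coeff_eq_0)
    then have "det R = prod_list (diag_mat R)"
      by (intro det_lower_triangular[of N]) (auto simp: R_def)
    then show ?thesis by (simp add: prod_list_diag_prod R_def lessThan_atLeast0)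
  qed
  moreover have "det (R * V) = det R * det V"
    by (rule det_mult[of _ N]) (simp_all add: R_def V_def)
  ultimately show ?thesis by (simp add: V_def)
qed


lemma degree_sine_poly: "degree (sine_poly j) = j" and lead_coeff_sine_poly: "lead_coeff (sine_poly j) = 1"
proof -
  have "sine_poly j \<noteq> 0 \<and> degree (sine_poly j) = j \<and> lead_coeff (sine_poly j) = 1"
  proof (induction j rule: sine_poly.induct)
    case (3 j)
    let ?A = "[:of_nat j ^ 2, 0, 1 :: rat:]"
    have A: "?A \<noteq> 0" "degree ?A = 2" "lead_coeff ?A = 1" by simp_all
    from 3 have S: "sine_poly j \<noteq> 0" "degree (sine_poly j) = j" "lead_coeff (sine_poly j) = 1"
      by blast+
    have "?A * sine_poly j \<noteq> 0" using A(1) S(1) no_zero_divisors by blast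
    moreover have "degree (?A * sine_poly j) = Suc (Suc j)"
      using degree_mult_eq[OF A(1) S(1)] A(2) S(2) by (metis add_2_eq_Suc)
    moreover have "lead_coeff (?A * sine_poly j) = 1"
      using lead_coeff_mult[of ?A "sine_poly j"] A(3) S(3) by (metis mult_1)
    ultimately show ?case by (simp only: sine_poly.simps simp_thms)
  qed simp_all
  then show "degree (sine_poly j) = j" "lead_coeff (sine_poly j) = 1" by auto
qed

lemma degree_prod_linear: "degree (\<Prod>k<i. [:c k, 1:] :: 'a :: idom poly) = i"
  by (subst degree_prod_eq_sum_degree) simp_all

lemma coeff_prod_linear: "coeff (\<Prod>k<i. [:c k, 1:] :: 'a :: idom poly) i = 1"
proof -
  have "lead_coeff (\<Prod>k<i. [:c k, 1:] :: 'a poly) = 1"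
    by (simp add: lead_coeff_prod)
  then show ?thesis by (simp add: degree_prod_linear)
qed

lemma pcompose_monom_square: "pcompose (monom 1 i) [:0, 0, 1 :: rat:] = monom 1 (2 * i)"
  by (induction i) (simp_all add: monom_0 monom_Suc pcompose_pCons)

lemma det_mat_swap: "det (mat N N (\<lambda>(i, j). f i j)) = det (mat N N (\<lambda>(i, j). f j i :: 'a :: comm_ring_1))"
proof -
  have "mat N N (\<lambda>(i, j). f j i) = transpose_mat (mat N N (\<lambda>(i, j). f i j))"
    by (rule eq_matI) simp_all
  then show ?thesis by (simp add: det_transpose[of _ N])
qed

text \<open>Consecutive rows of the dilated Hankel matrix differ by x^2, so row changes are
  polynomials in x^2.\<close>

lemma det_umbral_rows:
  assumes "\<And>i. degree (P i) \<le> i"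
  shows "det (mat N N (\<lambda>(i, j). umbral g (pcompose (P i) [:0, 0, 1:] * Q j))) =
    (\<Prod>i<N. coeff (P i) i) * det (mat N N (\<lambda>(i, j). umbral g (monom 1 (2 * i) * Q j)))"
  using det_linear_functionals[of "\<lambda>j p. umbral g (pcompose p [:0, 0, 1:] * Q j)" P N] assms
  by (simp add: pcompose_add pcompose_smult distrib_right umbral_add umbral_smult pcompose_monom_square)

lemma dilated_hankel_umbral:
  "dilated_hankel N g = det (mat N N (\<lambda>(i, j). umbral g (monom 1 (2 * i) * monom 1 j)))"
  by (simp add: dilated_hankel_def mult_monom umbral_monom)

text \<open>Splits off a factor depending only on the column; the rest is a polynomial in
  \<open>j\<close> of degree \<open>i\<close>, as a Vandermonde argument requires.\<close>

lemma double_fact_prod: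
  "double_fact (2 * i + j - 1) = double_fact (j - 1) * (\<Prod>k<i. j + 2 * k + 1)"
proof (induction i)
  case (Suc i)
  have "double_fact (2 * Suc i + j - 1) = (2 * i + j + 1) * double_fact (2 * i + j - 1)"
    using double_fact_Suc[of "2 * i + j"] by simp
  also have "\<dots> = double_fact (j - 1) * ((\<Prod>k<i. j + 2 * k + 1) * (j + 2 * i + 1))"
    unfolding Suc.IH by (simp only: mult_ac add_ac)
  finally show ?case by simp
qed simp

lemma dilated_hankel_sec1:
  "dilated_hankel N sec1 = (\<Prod>i<N. 2 ^ i * (fact i * of_nat (double_fact (i - 1))) ^ 2)"
proof -
  let ?d = "\<lambda>j. of_nat (double_fact (j - 1)) :: rat"
  \<comment> \<open>The column factor is squared: one copy comes from
    \<open>umbral_sec1_product\<close>, the other from \<open>double_fact_prod\<close>.\<close>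
  define \<phi> where "\<phi> = (\<lambda>j p. ?d j ^ 2 * poly p (of_nat j))"
  have lin: "\<phi> j (p + q) = \<phi> j p + \<phi> j q" "\<phi> j (smult c p) = c * \<phi> j p" for j p q c
    by (simp_all add: \<phi>_def algebra_simps)
  define P where "P = (\<lambda>i. smult (2 ^ i * fact i) (\<Prod>k<i. [:of_nat (2 * k + 1), 1:]) :: rat poly)"
  \<comment> \<open>Falling factorials: monic of degree \<open>i\<close> and zero at every
    \<open>j < i\<close>, so they make the matrix triangular with i! on the diagonal, up to the
    column factors.\<close>
  define F where "F = (\<lambda>i. (\<Prod>k<i. [:- of_nat k, 1:]) :: rat poly)"
  have "dilated_hankel N sec1 = det (mat N N (\<lambda>(j, i). umbral sec1 (monom 1 (2 * i) * monom 1 j)))"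
    unfolding dilated_hankel_umbral by (rule det_mat_swap)
  also have "\<dots> = det (mat N N (\<lambda>(j, i). umbral sec1 (monom 1 (2 * i) * sine_poly j)))"
    using det_linear_functionals[of "\<lambda>i p. umbral sec1 (monom 1 (2 * i) * p)" sine_poly N]
      lead_coeff_sine_poly
    by (simp add: degree_sine_poly distrib_left umbral_add umbral_smult)
  also have "\<dots> = det (mat N N (\<lambda>(i, j). umbral sec1 (monom 1 (2 * i) * sine_poly j)))"
    by (rule det_mat_swap)
  also have "\<dots> = det (mat N N (\<lambda>(i, j). umbral sec1 (pcompose (odd_square_poly i) [:0, 0, 1:] * sine_poly j)))"
    by (subst det_umbral_rows) (simp_all add: odd_square_poly_def degree_prod_linear coeff_prod_linear)
  also have "\<dots> = det (mat N N (\<lambda>(i, j). \<phi> j (P i)))"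
  proof -
    have "umbral sec1 (pcompose (odd_square_poly i) [:0, 0, 1:] * sine_poly j) = \<phi> j (P i)" for i j
      unfolding umbral_sec1_product double_fact_prod[of i j]
      by (simp add: \<phi>_def P_def poly_prod power2_eq_square algebra_simps)
    then show ?thesis by simp
  qed
  also have "\<dots> = (\<Prod>i<N. 2 ^ i * fact i) * det (mat N N (\<lambda>(i, j). \<phi> j (monom 1 i)))"
    using det_linear_functionals[of \<phi> P N] lin
    by (simp add: P_def degree_smult_eq degree_prod_linear coeff_prod_linear)
  also have "det (mat N N (\<lambda>(i, j). \<phi> j (monom 1 i))) = det (mat N N (\<lambda>(i, j). \<phi> j (F i)))"
    using det_linear_functionals[of \<phi> F N] lin
    by (simp add: F_def degree_prod_linear coeff_prod_linear)
  also have "\<dots> = (\<Prod>i<N. ?d i ^ 2 * fact i)"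
  proof -
    have "\<phi> j (F i) = 0" if "j < i" for i j
      using that by (auto simp: \<phi>_def F_def poly_prod)
    moreover have "\<phi> i (F i) = ?d i ^ 2 * fact i" for i
    proof -
      have "(\<Prod>k<i. of_nat i - of_nat k) = (of_nat (\<Prod>k<i. i - k) :: rat)"
        by (simp add: of_nat_diff)
      also have "\<dots> = fact i"
        by (simp add: fact_prod_rev lessThan_atLeast0)
      finally show ?thesis by (simp add: \<phi>_def F_def poly_prod)
    qed
    ultimately show ?thesis
      by (subst det_upper_triangular[of _ N]) (auto simp: prod_list_diag_prod lessThan_atLeast0)
  qed
  finally show ?thesis
    by (simp add: power2_eq_square mult_ac flip: prod.distrib)
qed


section \<open>Products of double factorials\<close>

text \<open>From N = m+1 to m+2 both sides gain ((m+1)!!)^2 (m!!)^4, because (m+1)! = (m+1)!!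
  m!!.\<close>

lemma prod_fact_double_fact:
  assumes "N \<ge> 1"
  shows "(\<Prod>i<N. (fact i * double_fact (i - 1)) ^ 2) =
    double_fact (N - 1) ^ 2 * (\<Prod>k = 1..N - 2. double_fact k ^ 6)"
  using assms
proof (induction N rule: dec_induct)
  case base
  show ?case by simp
next
  case (step n)
  then obtain m where n: "n = Suc m" by (cases n) auto
  have "(\<Prod>k = 1..m. double_fact k ^ 6) = double_fact m ^ 6 * (\<Prod>k = 1..m - 1. double_fact k ^ 6)"
    by (cases m) (simp_all add: mult.commute)
  moreover have "fact (Suc m) = double_fact (Suc m) * double_fact m"
    using double_fact_mult_pred[of "Suc m"] by simp
  ultimately show ?case
    using step.IH unfolding n
    by (simp add: power_mult_distrib eval_nat_numeral mult_ac del: fact_Suc double_fact.simps)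
qed

text \<open>Induction in steps of two: \<open>eps\<close> has period two, so the exponents of the
  old factorials stay the same.\<close>

lemma prod_fact_eps:
  "(\<Prod>k<N. (fact (N - Suc k) :: nat) ^ eps (Suc k)) = (\<Prod>i<N. (fact i * double_fact (i - 1)) ^ 2)"
proof (induction N rule: nat_induct2)
  case (step N)
  have "(\<Prod>k<Suc (Suc N). (fact (Suc (Suc N) - Suc k) :: nat) ^ eps (Suc k)) =
      fact (Suc N) ^ 2 * (fact N ^ 4 * (\<Prod>k<N. (fact (N - Suc k) :: nat) ^ eps (Suc k)))"
    unfolding prod.lessThan_Suc_shift by (simp add: eps_def del: fact_Suc)
  also have "\<dots> = (\<Prod>i<N. (fact i * double_fact (i - 1)) ^ 2) *
      (fact (Suc N) ^ 2 * fact N ^ 2 * (double_fact N * double_fact (N - 1)) ^ 2)"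
    unfolding step.IH double_fact_mult_pred
    by (simp add: eval_nat_numeral mult_ac del: fact_Suc)
  finally show ?case
    by (simp add: power_mult_distrib mult_ac del: fact_Suc)
qed (simp_all add: eps_def)

section \<open>The evaluation of palindromic polynomials\<close>

text \<open>
  The substitution \<open>x = (1 + z) / (1 - z)\<close> is a rational version of \<open>x = e\<^bsup>2it\<^esup>\<close>, with
  \<open>z = i tan t\<close>: homogenized, \<open>z\<^sup>m\<close> stands for \<open>c\<^bsup>d-m\<^esup> (i s)\<^sup>m\<close>.
\<close>

definition cayley :: "nat \<Rightarrow> rat poly \<Rightarrow> rat poly" where
  "cayley d P = (\<Sum>k\<le>d. smult (coeff P k) ([:1, 1:] ^ k * [:1, -1:] ^ (d - k)))"

lemma poly_cayley:
  assumes "degree P \<le> d" "z \<noteq> 1"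
  shows "poly (cayley d P) z = (1 - z) ^ d * poly P ((1 + z) / (1 - z))"
proof -
  let ?w = "(1 + z) / (1 - z)"
  have "poly P ?w = (\<Sum>k\<le>d. coeff P k * ?w ^ k)"
    unfolding poly_altdef using assms(1)
    by (intro sum.mono_neutral_left) (auto simp: coeff_eq_0)
  then have "(1 - z) ^ d * poly P ?w = (\<Sum>k\<le>d. coeff P k * ((1 - z) ^ d * ?w ^ k))"
    by (simp add: sum_distrib_left mult_ac)
  also have "\<dots> = (\<Sum>k\<le>d. coeff P k * ((1 + z) ^ k * (1 - z) ^ (d - k)))"
    using assms(2) by (intro sum.cong) (auto simp: power_divide power_diff divide_simps)
  also have "\<dots> = poly (cayley d P) z"
    by (simp add: cayley_def poly_sum)
  finally show ?thesis by (rule sym)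
qed

lemma cayley_eqI:
  assumes "degree P \<le> d" "\<And>z. z \<noteq> 1 \<Longrightarrow> (1 - z) ^ d * poly P ((1 + z) / (1 - z)) = poly R z"
  shows "cayley d P = R"
  by (rule poly_eqI_cofinite) (use assms poly_cayley in auto)

lemma cayley_add: "cayley d (P + Q) = cayley d P + cayley d Q"
  by (simp add: cayley_def smult_add_left sum.distrib)

lemma cayley_smult: "cayley d (smult c P) = smult c (cayley d P)"
  by (intro poly_eqI) (simp add: cayley_def coeff_sum sum_distrib_left mult.assoc)

text \<open>For w = (1+z)/(1-z) one has (1-z)(w-1) = 2z, so the denominator of \<open>N0\<close>
  turns into 4z^2.\<close>

lemma cayley_mult_square:
  assumes "degree Q \<le> d"
  shows "cayley (d + 2) (Q * [:-1, 1:] ^ 2) = smult 4 ([:0, 0, 1:] * cayley d Q)"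
proof (rule cayley_eqI)
  have "degree (Q * [:-1, 1:] ^ 2) \<le> degree Q + degree ([:-1, 1 :: rat:] ^ 2)"
    by (rule degree_mult_le)
  also have "degree ([:-1, 1 :: rat:] ^ 2) = 2"
    by (simp add: degree_power_eq)
  finally show "degree (Q * [:-1, 1:] ^ 2) \<le> d + 2" using assms by simp
next
  fix z :: rat
  assume z: "z \<noteq> 1"
  define w where "w = (1 + z) / (1 - z)"
  have "(1 - z) * (w - 1) = 2 * z"
    using z by (simp add: w_def field_simps)
  then have "((1 - z) * (w - 1)) ^ 2 = (2 * z) ^ 2"
    by (rule arg_cong)
  then have eq: "(1 - z) ^ 2 * (w - 1) ^ 2 = 4 * z ^ 2"
    by (simp only: power_mult_distrib) simp
  have "(1 - z) ^ (d + 2) * poly (Q * [:-1, 1:] ^ 2) w =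
      ((1 - z) ^ 2 * (w - 1) ^ 2) * ((1 - z) ^ d * poly Q w)"
    by (simp add: power_add power2_eq_square algebra_simps)
  also have "\<dots> = 4 * z ^ 2 * poly (cayley d Q) z"
    unfolding eq by (simp add: poly_cayley[OF assms z] w_def)
  also have "\<dots> = poly (smult 4 ([:0, 0, 1:] * cayley d Q)) z"
    by (simp add: power2_eq_square)
  finally show "(1 - z) ^ (d + 2) * poly (Q * [:-1, 1:] ^ 2) ((1 + z) / (1 - z)) =
      poly (smult 4 ([:0, 0, 1:] * cayley d Q)) z"
    unfolding w_def .
qed

lemma cayley_basis: "cayley (2 * i + j) ([:0, 1:] ^ i * [:1, 1:] ^ j) = smult (2 ^ j) ([:1, 0, -1:] ^ i)"
proof (rule cayley_eqI)
  show "degree ([:0, 1 :: rat:] ^ i * [:1, 1:] ^ j) \<le> 2 * i + j"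
    by (simp add: degree_mult_eq degree_power_eq)
next
  fix z :: rat
  assume z: "z \<noteq> 1"
  let ?w = "(1 + z) / (1 - z)"
  have "(1 - z) ^ 2 * ?w = 1 - z * z" "(1 - z) * (1 + ?w) = 2"
    using z by (simp_all add: field_simps power2_eq_square)
  then have "((1 - z) ^ 2 * ?w) ^ i * ((1 - z) * (1 + ?w)) ^ j = (1 - z * z) ^ i * 2 ^ j"
    by simp
  moreover have "(1 - z) ^ (2 * i + j) * (?w ^ i * (1 + ?w) ^ j) = ((1 - z) ^ 2 * ?w) ^ i * ((1 - z) * (1 + ?w)) ^ j"
    unfolding power_add power_mult by (simp only: power_mult_distrib mult_ac)
  ultimately show "(1 - z) ^ (2 * i + j) * poly ([:0, 1:] ^ i * [:1, 1:] ^ j) ?w =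
      poly (smult (2 ^ j) ([:1, 0, -1:] ^ i)) z"
    by (simp add: mult.commute)
qed

text \<open>
  The factor \<open>m!\<close> times the \<open>m\<close>-th coefficient of the cosine is \<open>i\<^sup>m\<close> for even \<open>m\<close> and 0 for odd \<open>m\<close>.
\<close>

definition cayley_functional :: "nat \<Rightarrow> rat poly \<Rightarrow> rat" where
  "cayley_functional d R =
    (\<Sum>m\<le>d. (fact m * fps_nth (fps_cos 1) m) * (fact (d - m) * fps_nth sec1 (d - m)) * coeff R m)"

lemma cayley_functional_add: "cayley_functional d (P + Q) = cayley_functional d P + cayley_functional d Q"
  by (simp add: cayley_functional_def distrib_left sum.distrib)

lemma cayley_functional_smult: "cayley_functional d (smult c P) = c * cayley_functional d P"
  by (simp add: cayley_functional_def sum_distrib_left mult_ac)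

text \<open>Raising both \<open>d\<close> and the exponent m by 2 keeps d - m and changes the sign
  of the cosine coefficient times m!.\<close>

lemma cayley_functional_shift:
  "cayley_functional (d + 2) ([:0, 0, 1:] * R) = - cayley_functional d R"
proof -
  have "fact (m + 2) * fps_nth (fps_cos 1) (m + 2) = - (fact m * fps_nth (fps_cos 1) m :: rat)" for m
  proof -
    have "fact (m + 2) = of_nat (m + 1) * of_nat (m + 2) * (fact m :: rat)" by simp
    then show ?thesis
      unfolding fps_cos_nth_add_2 by (simp del: of_nat_Suc of_nat_add)
  qed
  then show ?thesis
    by (simp add: cayley_functional_def sum.atMost_Suc_shift sum_negf flip: numeral_2_eq_2
        del: fact_Suc sum.atMost_Suc)
qed

text \<open>The image of x^d + 1 is (1+z)^d + (1-z)^d, whose value is 2 d! times the coefficient of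
  x^d in f cos x = 1 + x.\<close>

lemma cayley_functional_vanishes:
  assumes "d \<ge> 2"
  shows "cayley_functional d (cayley d (monom 1 d + 1)) = 0"
proof -
  have "cayley d (monom 1 d + 1) = [:1, 1:] ^ d + [:1, -1:] ^ d"
  proof (rule cayley_eqI)
    show "degree (monom (1 :: rat) d + 1) \<le> d"
      by (intro degree_add_le) (simp_all add: degree_monom_eq)
  next
    fix z :: rat
    assume "z \<noteq> 1"
    then have "(1 - z) ^ d * ((1 + z) / (1 - z)) ^ d = (1 + z) ^ d"
      by (simp flip: power_mult_distrib)
    then show "(1 - z) ^ d * poly (monom 1 d + 1) ((1 + z) / (1 - z)) = poly ([:1, 1:] ^ d + [:1, -1:] ^ d) z"
      by (simp add: poly_monom distrib_left)
  qed
  then have "cayley_functional d (cayley d (monom 1 d + 1)) =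
     (\<Sum>m\<le>d. (fact m * fps_nth (fps_cos 1) m) * (fact (d - m) * fps_nth sec1 (d - m)) * (of_nat (d choose m) * (1 + (-1) ^ m)))"
    by (simp add: cayley_functional_def coeff_linear_poly_power distrib_left)
  also have "\<dots> = (\<Sum>m\<le>d. 2 * fact d * (fps_nth (fps_cos 1) m * fps_nth sec1 (d - m)))"
  proof (intro sum.cong refl)
    fix m assume "m \<in> {..d}"
    then have "fact m * fact (d - m) * (d choose m) = (fact d :: nat)"
      by (intro binomial_fact_lemma) simp
    then have "of_nat (fact m * fact (d - m) * (d choose m)) = (of_nat (fact d) :: rat)"
      by (rule arg_cong)
    then have fact: "fact m * fact (d - m) * of_nat (d choose m) = (fact d :: rat)"
      by (simp only: of_nat_mult of_nat_fact)
    have cos: "fps_nth (fps_cos 1) m * (1 + (-1) ^ m) = (2 * fps_nth (fps_cos 1) m :: rat)"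
      by (simp add: fps_cos_def)
    have "(fact m * fps_nth (fps_cos 1) m) * (fact (d - m) * fps_nth sec1 (d - m)) * (of_nat (d choose m) * (1 + (-1) ^ m))
        = (fact m * fact (d - m) * of_nat (d choose m)) * ((fps_nth (fps_cos 1) m * (1 + (-1) ^ m)) * fps_nth sec1 (d - m))"
      by (simp only: mult_ac)
    also have "\<dots> = 2 * fact d * (fps_nth (fps_cos 1) m * fps_nth sec1 (d - m))"
      unfolding fact cos by (simp only: mult_ac)
    finally show "(fact m * fps_nth (fps_cos 1) m) * (fact (d - m) * fps_nth sec1 (d - m)) * (of_nat (d choose m) * (1 + (-1) ^ m))
        = 2 * fact d * (fps_nth (fps_cos 1) m * fps_nth sec1 (d - m))" .
  qed
  also have "\<dots> = 2 * fact d * fps_nth (fps_cos 1 * sec1) d"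
    by (simp add: fps_mult_nth sum_distrib_left atLeast0AtMost)
  also have "fps_cos 1 * sec1 = 1 + fps_X"
    using sec1_mult_cos by (simp only: mult.commute)
  also have "2 * fact d * fps_nth (1 + fps_X) d = (0 :: rat)"
    using assms by simp
  finally show ?thesis .
qed

text \<open>Each application of \<open>N0\<close> halves the functional, and the base case of index
  1 contributes one more factor 2. Using \<open>d\<close> instead of \<open>pindex P\<close> lets
  the induction cover the case that \<open>N0 P\<close> is zero.\<close>

lemma iterate_N0_eq_cayley:
  assumes "palindromic d P" "degree P \<le> d"
  shows "coeff ((N0 ^^ (d div 2)) P) 0 = cayley_functional d (cayley d P) / 2 ^ ((d + 1) div 2)"
  using assms
proof (induction d arbitrary: P rule: nat_induct2)
  case 0
  then obtain c where "P = [:c:]" by (auto elim: degree_eq_zeroE)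
  then show ?case by (simp add: cayley_def cayley_functional_def sec1_def)
next
  case 1
  define a b where "a = coeff P 0" and "b = coeff P 1"
  have P: "P = [:a, b:]"
    using 1(2) by (intro poly_eqI) (auto simp: a_def b_def coeff_pCons coeff_eq_0 split: nat.splits)
  \<comment> \<open>Palindromicity at the single point 2 already forces equal coefficients.\<close>
  have "2 * poly P (1 / 2) = poly P 2"
    using 1(1) unfolding palindromic_def by (metis power_one_right zero_neq_numeral)
  then have "a = b" by (simp add: P)
  then show ?case by (simp add: P cayley_def cayley_functional_def sec1_nth_1)
next
  case (step d)
  show ?case
  proof (cases "P = 0")
    case True
    have "(N0 ^^ n) 0 = 0" for n by (induction n) (simp_all add: N0_def)
    then have "coeff ((N0 ^^ ((d + 2) div 2)) P) 0 = 0" by (simp only: True coeff_0)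
    moreover have "cayley_functional (d + 2) (cayley (d + 2) P) = 0"
      by (simp add: True cayley_def cayley_functional_def)
    ultimately show ?thesis by (simp only: div_0)
  next
    case False
    have pal: "palindromic d (N0 P)"
      using palindromic_N0[OF step.prems(1) False] by simp
    have deg: "degree (N0 P) \<le> d"
      using palindromic_pindex[OF pal] by (cases "N0 P = 0") (auto simp: pindex_def)
    have "N0 P * [:-1, 1:] ^ 2 = smult (poly P 1) (monom 1 (d + 2) + 1) + smult (- 2) P"
      unfolding N0_exact[OF step.prems(1) False]
      by (simp add: N0_num_def palindromic_pindex[OF step.prems(1) False])
    then have "cayley_functional (d + 2) (cayley (d + 2) (N0 P * [:-1, 1:] ^ 2)) =
        - 2 * cayley_functional (d + 2) (cayley (d + 2) P)"
      using cayley_functional_vanishes[of "d + 2"]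
      by (simp only: cayley_add cayley_smult cayley_functional_add cayley_functional_smult)
    then have "2 * cayley_functional d (cayley d (N0 P)) = cayley_functional (d + 2) (cayley (d + 2) P)"
      by (simp only: cayley_mult_square[OF deg] cayley_functional_smult cayley_functional_shift)
    moreover have "(N0 ^^ ((d + 2) div 2)) P = (N0 ^^ (d div 2)) (N0 P)"
      by (simp add: funpow_swap1)
    ultimately show ?thesis
      using step.IH[OF pal deg] by (simp add: field_simps)
  qed
qed

text \<open>By the sign in the shift rule, a factor 1 - z^2 produces the sum of the values at
  indices d + 2 and d, just as a factor 1 + x^2 does for \<open>umbral\<close>.\<close>

lemma cayley_functional_power:
  "cayley_functional (2 * i + j) ([:1, 0, -1:] ^ i) = umbral sec1 ([:1, 0, 1:] ^ i * monom 1 j)"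
proof (induction i arbitrary: j)
  case 0
  have "cayley_functional j 1 = fact j * fps_nth sec1 j"
    unfolding cayley_functional_def by (subst sum.remove[of _ 0]) auto
  then show ?case by (simp add: umbral_monom)
next
  case (Suc i)
  have "[:1, 0, -1:] ^ Suc i = [:1, 0, -1:] ^ i + smult (-1) ([:0, 0, 1 :: rat:] * [:1, 0, -1:] ^ i)"
    by simp
  then have "cayley_functional (2 * Suc i + j) ([:1, 0, -1:] ^ Suc i) =
      cayley_functional (2 * i + (j + 2)) ([:1, 0, -1:] ^ i) + cayley_functional (2 * i + j) ([:1, 0, -1:] ^ i)"
    using cayley_functional_shift[of "2 * i + j" "[:1, 0, -1:] ^ i"]
    by (simp only: cayley_functional_add cayley_functional_smult) (simp add: algebra_simps)
  also have "\<dots> = umbral sec1 ([:1, 0, 1:] ^ i * monom 1 (j + 2) + [:1, 0, 1:] ^ i * monom 1 j)"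
    by (simp only: Suc.IH umbral_add)
  also have "[:1, 0, 1:] ^ i * monom 1 (j + 2) + [:1, 0, 1:] ^ i * monom 1 j = [:1, 0, 1 :: rat:] ^ Suc i * monom 1 j"
    by (simp add: monom_Suc algebra_simps)
  finally show ?case .
qed

lemma rho_basis:
  "rho ([:0, 1:] ^ i * [:1, 1:] ^ j) * (1 / 2 ^ (j div 2)) = umbral sec1 ([:1, 0, 1:] ^ i * monom 1 j) / 2 ^ i"
proof -
  let ?P = "[:0, 1:] ^ i * [:1, 1:] ^ j :: rat poly"
  have pal: "palindromic (2 * i + j) ?P" by (rule palindromic_x_power_1_plus_x_power)
  have idx: "pindex ?P = 2 * i + j" by (rule palindromic_pindex[OF pal]) simp
  then have "degree ?P \<le> 2 * i + j" by (simp add: pindex_def)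
  then have rho: "rho ?P = 2 ^ j * umbral sec1 ([:1, 0, 1:] ^ i * monom 1 j) / 2 ^ ((2 * i + j + 1) div 2)"
    unfolding rho_def idx
    by (simp only: iterate_N0_eq_cayley[OF pal] cayley_basis cayley_functional_smult cayley_functional_power)
  \<comment> \<open>The normalization by \<open>2 ^ (j div 2)\<close> completes the exponent to i +
    j, which cancels the \<open>2 ^ j\<close> from \<open>cayley_basis\<close> for either parity of
    \<open>j\<close>.\<close>
  have "(2 * i + j + 1) div 2 + j div 2 = i + j" by presburger
  then have pow: "(2 :: rat) ^ ((2 * i + j + 1) div 2) * 2 ^ (j div 2) = 2 ^ i * 2 ^ j"
    by (simp only: flip: power_add)
  have "rho ?P * (1 / 2 ^ (j div 2)) =
      2 ^ j * umbral sec1 ([:1, 0, 1:] ^ i * monom 1 j) / (2 ^ ((2 * i + j + 1) div 2) * 2 ^ (j div 2))"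
    unfolding rho by simp
  also have "\<dots> = umbral sec1 ([:1, 0, 1:] ^ i * monom 1 j) / 2 ^ i"
    unfolding pow by simp
  finally show ?thesis .
qed

section \<open>Comparison of the two determinants\<close>

lemma prod_power_lessThan: "(\<Prod>i<N. c ^ i) = (c :: 'a :: comm_monoid_mult) ^ (N choose 2)"
  by (induction N) (simp_all add: numeral_2_eq_2 power_add mult.commute)

lemma det_M_mat: "det (M_mat N) = 1 / 2 ^ (N choose 2) * dilated_hankel N sec1"
proof -
  \<comment> \<open>Row \<open>i\<close> of \<open>M_mat\<close> comes from ((1 + x^2)/2)^i; the
    leading coefficients 2^(-i) multiply to the power of 2 in the claim.\<close>
  define P where "P = (\<lambda>i. smult (1 / 2 ^ i) ([:1, 1 :: rat:] ^ i))"
  have deg: "degree (P i) \<le> i" for i by (simp add: P_def degree_power_eq)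
  have lead: "coeff (P i) i = (1 / 2) ^ i" for i
    by (simp add: P_def coeff_linear_poly_power power_one_over)
  have "pcompose ([:1, 1 :: rat:] ^ i) [:0, 0, 1:] = [:1, 0, 1:] ^ i" for i
    by (induction i) (simp_all only: power_0 power_Suc pcompose_1 pcompose_mult pcompose_linear_square)
  then have "umbral sec1 (pcompose (P i) [:0, 0, 1:] * monom 1 j) =
      rho ([:0, 1:] ^ i * [:1, 1:] ^ j) * (1 / 2 ^ (j div 2))" for i j
    unfolding rho_basis by (simp add: P_def pcompose_smult umbral_smult)
  then have "det (M_mat N) = det (mat N N (\<lambda>(i, j). umbral sec1 (pcompose (P i) [:0, 0, 1:] * monom 1 j)))"
    by (simp add: M_mat_def)
  also have "\<dots> = 1 / 2 ^ (N choose 2) * dilated_hankel N sec1"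
    unfolding det_umbral_rows[of P, OF deg] lead prod_power_lessThan dilated_hankel_umbral
    by (simp add: power_one_over)
  finally show ?thesis .
qed

theorem theorem26p1:
  fixes N :: nat
  assumes "N \<ge> 1"
  shows "det (M_mat N) = 1 / 2 ^ (N choose 2) * dilated_hankel N ((1 + fps_X) / fps_cos 1)
    \<and> 1 / 2 ^ (N choose 2) * dilated_hankel N ((1 + fps_X) / fps_cos 1)
        = of_nat (double_fact (N - 1) ^ 2 * (\<Prod>k = 1..N - 2. double_fact k ^ 6))
    \<and> of_nat (double_fact (N - 1) ^ 2 * (\<Prod>k = 1..N - 2. double_fact k ^ 6))
        = (\<Prod>k = 1..N - 1. (fact (N - k) :: rat) ^ eps k)"
proof (intro conjI)
  let ?closed = "double_fact (N - 1) ^ 2 * (\<Prod>k = 1..N - 2. double_fact k ^ 6)"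
  note closed = prod_fact_double_fact[OF assms]
  show "det (M_mat N) = 1 / 2 ^ (N choose 2) * dilated_hankel N ((1 + fps_X) / fps_cos 1)"
    using det_M_mat unfolding sec1_def .
  have "dilated_hankel N sec1 = 2 ^ (N choose 2) * of_nat (\<Prod>i<N. (fact i * double_fact (i - 1)) ^ 2)"
    by (simp add: dilated_hankel_sec1 prod.distrib prod_power_lessThan)
  then show "1 / 2 ^ (N choose 2) * dilated_hankel N ((1 + fps_X) / fps_cos 1) = of_nat ?closed"
    unfolding closed sec1_def by simp
  obtain n where N: "N = Suc n" using assms by (cases N) auto
  have "(\<Prod>k = 1..N - 1. (fact (N - k) :: nat) ^ eps k) = (\<Prod>k<N. fact (N - Suc k) ^ eps (Suc k))"
    unfolding N by (simp add: prod.atLeast1_atMost_eq)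
  then have "?closed = (\<Prod>k = 1..N - 1. fact (N - k) ^ eps k)"
    unfolding prod_fact_eps closed by simp
  then show "of_nat ?closed = (\<Prod>k = 1..N - 1. (fact (N - k) :: rat) ^ eps k)"
    by simp
qed

end
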